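(* Let $(D,\dashv,\vdash,\perp)$ be a triassociative algebra over a field of characteristic $0$. Then the vector space $D$ is a tridendriform algebra with the operations $$x\prec y=x\dashv y,\qquad x\succ y=x\vdash y,\qquad x\curlyvee y=-\,x\perp y\qquad(x,y\in D).$$
   Context: A triassociative algebra is a vector space $D$ with three bilinear operations $\dashv,\vdash,\perp$ such that for all $x,y,z\in D$: $(x\dashv y)\dashv z=x\dashv(y\dashv z)=x\dashv(y\vdash z)=x\dashv(y\perp z)$; $(x\vdash y)\dashv z=x\vdash(y\dashv z)$; $(x\dashv y)\vdash z=(x\vdash y)\vdash z=(x\perp y)\vdash z=x\vdash(y\vdash z)$; $(x\perp y)\dashv z=x\perp(y\dashv z)$; $(x\dashv y)\perp z=x\perp(y\vdash z)$; $(x\vdash y)\perp z=x\vdash(y\perp z)$; $(x\perp y)\perp z=x\perp(y\perp z)$. A tridendriform algebra (Loday–Ronco) is a vector space with three bilinear operations $\prec,\succ,\curlyvee$ such that, with $x*y=x\prec y+x\succ y+x\curlyvee y$, for all $x,y,z$: $(x\prec y)\prec z=x\prec(y*z)$; $(x\succ y)\prec z=x\succ(y\prec z)$; $(x*y)\succ z=x\succ(y\succ z)$; $(x\succ y)\curlyvee z=x\succ(y\curlyvee z)$; $(x\prec y)\curlyvee z=x\curlyvee(y\succ z)$; $(x\curlyvee y)\prec z=x\curlyvee(y\prec z)$; $(x\curlyvee y)\curlyvee z=x\curlyvee(y\curlyvee z)$. *)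

theory Defs
  imports Complex_Main
begin

definition bilinear_op ::
    "('k::field \<Rightarrow> 'd::ab_group_add \<Rightarrow> 'd) \<Rightarrow> ('d \<Rightarrow> 'd \<Rightarrow> 'd) \<Rightarrow> bool" where
  "bilinear_op scale f \<longleftrightarrow>
     (\<forall>x. Vector_Spaces.linear scale scale (\<lambda>y. f x y)) \<and>
     (\<forall>y. Vector_Spaces.linear scale scale (\<lambda>x. f x y))"

locale triassociative_algebra = vector_space scale
  for scale :: "'k::field \<Rightarrow> 'd::ab_group_add \<Rightarrow> 'd" +
  fixes left :: "'d \<Rightarrow> 'd \<Rightarrow> 'd"  (infixl "\<stileturn>" 70)
    and right :: "'d \<Rightarrow> 'd \<Rightarrow> 'd"  (infixl "\<turnstile>" 70)
    and middle :: "'d \<Rightarrow> 'd \<Rightarrow> 'd"  (infixl "\<perp>" 70)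
  assumes bilinear_left: "bilinear_op scale (\<stileturn>)"
    and bilinear_right: "bilinear_op scale (\<turnstile>)"
    and bilinear_middle: "bilinear_op scale (\<perp>)"
    and left_left: "(x \<stileturn> y) \<stileturn> z = x \<stileturn> (y \<stileturn> z)"
    and left_inner_right: "x \<stileturn> (y \<stileturn> z) = x \<stileturn> (y \<turnstile> z)"
    and left_inner_middle: "x \<stileturn> (y \<turnstile> z) = x \<stileturn> (y \<perp> z)"
    and right_left: "(x \<turnstile> y) \<stileturn> z = x \<turnstile> (y \<stileturn> z)"
    and right_inner_left: "(x \<stileturn> y) \<turnstile> z = (x \<turnstile> y) \<turnstile> z"
    and right_inner_middle: "(x \<turnstile> y) \<turnstile> z = (x \<perp> y) \<turnstile> z"
    and middle_right_right: "(x \<perp> y) \<turnstile> z = x \<turnstile> (y \<turnstile> z)"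
    and middle_left: "(x \<perp> y) \<stileturn> z = x \<perp> (y \<stileturn> z)"
    and left_middle: "(x \<stileturn> y) \<perp> z = x \<perp> (y \<turnstile> z)"
    and right_middle: "(x \<turnstile> y) \<perp> z = x \<turnstile> (y \<perp> z)"
    and middle_middle: "(x \<perp> y) \<perp> z = x \<perp> (y \<perp> z)"

definition tridendriform_sum ::
    "('d \<Rightarrow> 'd \<Rightarrow> 'd) \<Rightarrow> ('d \<Rightarrow> 'd \<Rightarrow> 'd) \<Rightarrow> ('d \<Rightarrow> 'd \<Rightarrow> 'd) \<Rightarrow> 'd \<Rightarrow> 'd \<Rightarrow> 'd::ab_group_add" where
  "tridendriform_sum prec succ vee x y = prec x y + succ x y + vee x y"

locale tridendriform_algebra = vector_space scale
  for scale :: "'k::field \<Rightarrow> 'd::ab_group_add \<Rightarrow> 'd" +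
  fixes prec :: "'d \<Rightarrow> 'd \<Rightarrow> 'd"  (infixl "\<prec>" 70)
    and succ :: "'d \<Rightarrow> 'd \<Rightarrow> 'd"  (infixl "\<succ>" 70)
    and vee :: "'d \<Rightarrow> 'd \<Rightarrow> 'd"  (infixl "\<curlyvee>" 70)
  assumes bilinear_prec: "bilinear_op scale (\<prec>)"
    and bilinear_succ: "bilinear_op scale (\<succ>)"
    and bilinear_vee: "bilinear_op scale (\<curlyvee>)"
    and prec_prec: "(x \<prec> y) \<prec> z = x \<prec> tridendriform_sum (\<prec>) (\<succ>) (\<curlyvee>) y z"
    and succ_prec: "(x \<succ> y) \<prec> z = x \<succ> (y \<prec> z)"
    and sum_succ: "tridendriform_sum (\<prec>) (\<succ>) (\<curlyvee>) x y \<succ> z = x \<succ> (y \<succ> z)"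
    and succ_vee: "(x \<succ> y) \<curlyvee> z = x \<succ> (y \<curlyvee> z)"
    and prec_vee: "(x \<prec> y) \<curlyvee> z = x \<curlyvee> (y \<succ> z)"
    and vee_prec: "(x \<curlyvee> y) \<prec> z = x \<curlyvee> (y \<prec> z)"
    and vee_vee: "(x \<curlyvee> y) \<curlyvee> z = x \<curlyvee> (y \<curlyvee> z)"

end

(* In the two axioms involving the sum x * y, the three products of x and y become equal once
   multiplied by z on the relevant side, so the sum contributes a + a - a = a. In the other
   axioms both sides carry the same sign, which bilinearity pulls out. *)
theory Submission
  imports Defs
begin

text \<open>The rules for sums, negatives and differences below all come from
  \<open>module_hom\<close>.\<close>

lemma bilinear_op_module_hom:
  assumes "bilinear_op scale f"
  shows "module_hom scale scale (f x)" "module_hom scale scale (\<lambda>x. f x y)"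
  using assms by (simp_all add: bilinear_op_def module_hom_iff_linear)

lemma bilinear_op_add:
  assumes "bilinear_op scale f"
  shows "f x (y + z) = f x y + f x z" "f (x + y) z = f x z + f y z"
  using bilinear_op_module_hom[OF assms] by (blast dest: module_hom.add)+

lemma bilinear_op_neg:
  assumes "bilinear_op scale f"
  shows "f x (- y) = - f x y" "f (- x) y = - f x y"
  using bilinear_op_module_hom[OF assms] by (blast dest: module_hom.neg)+

lemma bilinear_op_diff:
  assumes "bilinear_op scale f"
  shows "f x (y - z) = f x y - f x z" "f (x - y) z = f x z - f y z"
  using bilinear_op_module_hom[OF assms] by (blast dest: module_hom.diff)+

text \<open>Negation commutes with addition and scaling; this serves the operation
  \<open>- middle x y\<close>.\<close>

lemma bilinear_op_uminus:
  assumes "bilinear_op scale f"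
  shows "bilinear_op scale (\<lambda>x y. - f x y)"
  using assms unfolding bilinear_op_def
  by (auto simp: Vector_Spaces.linear_iff module.scale_minus_right
      \<comment> \<open>\<open>module.scale_minus_right\<close> has a \<open>module\<close> premise,
        so \<open>vector_space\<close> is rewritten to \<open>module\<close>.\<close>
      simp flip: module_iff_vector_space)

theorem mainTheorem12:
  fixes scale :: "'k::field_char_0 \<Rightarrow> 'd::ab_group_add \<Rightarrow> 'd"
    and left right middle :: "'d \<Rightarrow> 'd \<Rightarrow> 'd"
  assumes "triassociative_algebra scale left right middle"
  shows "tridendriform_algebra scale
           (\<lambda>x y. left x y) (\<lambda>x y. right x y) (\<lambda>x y. - middle x y)"
proof -
  interpret triassociative_algebra scale left right middle by fact
  note bilin = bilinear_left bilinear_right bilinear_middle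
  note linear_simps = bilin[THEN bilinear_op_add(1)] bilin[THEN bilinear_op_add(2)]
    bilin[THEN bilinear_op_neg(1)] bilin[THEN bilinear_op_neg(2)]
    \<comment> \<open>Simplification turns \<open>a + - b\<close> into \<open>a - b\<close>, so the
      sum reaches the products as a difference.\<close>
    bilin[THEN bilinear_op_diff(1)] bilin[THEN bilinear_op_diff(2)]
  show ?thesis
    \<comment> \<open>Read left to right, each chain of axioms leads to one normal form:
      \<open>left x (middle y z)\<close> or \<open>right x (right y z)\<close>.\<close>
    by unfold_locales
      (simp_all add: bilinear_op_uminus bilin tridendriform_sum_def linear_simps
        left_left left_inner_right left_inner_middle right_left right_inner_left
        right_inner_middle middle_right_right middle_left left_middle right_middle
        middle_middle)
qed

end
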